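(* For $k\in\mathbb{N}$ define $\alpha_k$ and $\beta_k$ by $$\tau_{k+5,k}=\frac{1}{2k+1}\Big(\frac{4}{k+4}\Big)^{3/2}\alpha_k,\qquad \tau_{k+6,k}=\frac{1}{2k+1}\Big(\frac{5}{k+5}\Big)^{2}\beta_k .$$ Then $\tau_{n,k}\le\tau_{k+5,k}$ for $n\ge k+5$ and $\tau_{n,k}\le \tau_{k+6,k}$ for $n\ge k+6$; moreover the sequences $(\alpha_k)$ and $(\beta_k)$ are strictly increasing in $k$ and converge to $$\alpha_*=\frac{\sqrt{3(3+\sqrt6)}}{4}=1.0108\ldots,\qquad \beta_*=\frac{2+\sqrt{10}}{5}=1.0325\ldots,$$ respectively, with $\alpha_k<\alpha_*$ and $\beta_k<\beta_*$ for all $k$.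
   Context: $T_n$ denotes the Chebyshev polynomial of the first kind of degree $n$, $T_n(\cos\theta)=\cos n\theta$. For integers $n\ge k+2$, $k\ge 1$, let $\omega_{n,k}$ be the rightmost (largest) zero of $T_n^{(k+1)}$ and define $\tau_{n,k}:=|T_n^{(k)}(\omega_{n,k})|/T_n^{(k)}(1)$. *)

theory Defs
  imports "HOL-Analysis.Analysis" "HOL-Computational_Algebra.Polynomial"
begin

text \<open>Chebyshev polynomials of the first kind, via the three-term recurrence
  T_0 = 1, T_1 = x, T_(n+2) = 2 x T_(n+1) - T_n  (so that T_n(cos t) = cos(n t)).\<close>
fun cheb :: "nat \<Rightarrow> real poly" where
  "cheb 0 = 1"
| "cheb (Suc 0) = [:0, 1:]"
| "cheb (Suc (Suc n)) = [:0, 2:] * cheb (Suc n) - cheb n"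

definition cheb_deriv :: "nat \<Rightarrow> nat \<Rightarrow> real poly" where
  "cheb_deriv n k = (pderiv ^^ k) (cheb n)"

definition omega :: "nat \<Rightarrow> nat \<Rightarrow> real" where
  "omega n k = Max {x. poly (cheb_deriv n (Suc k)) x = 0}"

definition tau :: "nat \<Rightarrow> nat \<Rightarrow> real" where
  "tau n k = \<bar>poly (cheb_deriv n k) (omega n k)\<bar> / poly (cheb_deriv n k) 1"

definition alpha :: "nat \<Rightarrow> real" where
  "alpha k = tau (k + 5) k * (2 * real k + 1) * ((real k + 4) / 4) powr (3/2)"

definition beta :: "nat \<Rightarrow> real" where
  "beta k = tau (k + 6) k * (2 * real k + 1) * ((real k + 5) / 5) ^ 2"

definition alpha_star :: real where
  "alpha_star = sqrt (3 * (3 + sqrt 6)) / 4"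

definition beta_star :: real where
  "beta_star = (2 + sqrt 10) / 5"

end

theory Submission
  imports Defs "HOL-Real_Asymp.Real_Asymp"
begin

text \<open>Fix k and let a and b be the k-th derivatives of T_n and T_(n+1), normalised to be 1 at 1.
  They satisfy a first-order system, (1 - x^2) a' = (n + k) (x a - b) and
  (1 - x^2) b' = (n + 1 - k) (a - x b). Hence D = (a^2 - 2 x a b + b^2) / (1 - x^2) has derivative
  4 k (x a - b) (a - x b) / (1 - x^2)^2, whose sign is that of a' b'. Between the rightmost critical
  points y of a and z of b one has y < z, a' > 0 and b' < 0, so D decreases there,
  while D(y) = a(y)^2 and D(z) = b(z)^2; thus tau decreases in n.

  For n = k + 5 and n = k + 6 the critical points solve biquadratic equations. In terms of
  s = sqrt (6 - 3 / (k + 3)), respectively s = sqrt (10 - 15 / (k + 4)), which are increasing in k,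
  alpha_k = (3 + s)^(3/2) / (sqrt 8 (2 + s)) and beta_k = 2 (5 + s)^2 / (25 (2 + s)),
  and both expressions increase with s.\<close>

subsection \<open>Differential recurrences\<close>

lemma cheb_deriv_0 [simp]: "cheb_deriv n 0 = cheb n"
  by (simp add: cheb_deriv_def)

lemma pderiv_cheb_deriv: "pderiv (cheb_deriv n k) = cheb_deriv n (Suc k)"
  by (simp add: cheb_deriv_def)

lemma has_field_derivative_cheb_deriv [derivative_intros]:
  "(f has_real_derivative D) (at x within S) \<Longrightarrow>
    ((\<lambda>x. poly (cheb_deriv n k) (f x)) has_real_derivative
      D * poly (cheb_deriv n (Suc k)) (f x)) (at x within S)"
  using DERIV_chain2[where f = "poly (cheb_deriv n k)" and g = f,
      OF poly_DERIV[of "cheb_deriv n k" "f x"]]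
  by (simp add: pderiv_cheb_deriv mult.commute)

text \<open>Since \<open>T_n' = n U_(n-1)\<close>, with U of the second kind, these are
  \<open>U_n = x U_(n-1) + T_n\<close> and \<open>x U_n = U_(n-1) + T_(n+1)\<close> multiplied by
  \<open>n (n + 1)\<close>. They are proved jointly because the induction step needs both.\<close>

lemma cheb_deriv_relations_0:
  fixes n :: nat and x :: real and T T' :: "nat \<Rightarrow> real"
  defines "T \<equiv> (\<lambda>n. poly (cheb n) x) :: nat \<Rightarrow> real"
    and "T' \<equiv> (\<lambda>n. poly (cheb_deriv n 1) x) :: nat \<Rightarrow> real"
  shows "n * T' (Suc n) = (n + 1) * (x * T' n + n * T n) \<and>
    n * x * T' (Suc n) = (n + 1) * T' n + real n * (real n + 1) * T (Suc n)"
proof (induction n)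
  case 0
  show ?case by (simp add: T_def T'_def cheb_deriv_def)
next
  case (Suc n)
  have T2: "T (Suc (Suc n)) = 2 * x * T (Suc n) - T n"
    by (simp add: T_def)
  have T2': "T' (Suc (Suc n)) = 2 * T (Suc n) + 2 * x * T' (Suc n) - T' n"
    by (simp add: T'_def T_def cheb_deriv_def pderiv_mult pderiv_diff pderiv_pCons pderiv_smult)
  define u where "u = T' (Suc n)"
  define r where "r = real n"
  have A: "r * u = (r + 1) * (x * T' n + r * T n)"
   and B: "r * x * u = (r + 1) * T' n + r * (r + 1) * T (Suc n)"
    using Suc by (simp_all add: u_def r_def)
  have r0: "r \<ge> 0" by (simp add: r_def)
  have A2: "(r + 1) * T' (Suc (Suc n)) = (r + 2) * (x * u + (r + 1) * T (Suc n))"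
    using B unfolding T2' u_def[symmetric] by algebra
  \<comment> \<open>Eliminating \<open>T' n\<close> from \<open>A\<close> and \<open>B\<close> gives
    this identity only times \<open>r\<close>, so \<open>n = 0\<close> is checked directly.
    \<open>B2\<close> depends on it.\<close>
  have "(r + 1) * ((1 - x\<^sup>2) * u) = (r + 1) * ((r + 1) * (T n - x * T (Suc n)))"
  proof (cases "n = 0")
    case True
    then show ?thesis by (simp add: u_def r_def T_def T'_def cheb_deriv_def pderiv_pCons power2_eq_square)
  next
    case False
    then have "r \<noteq> 0" by (simp add: r_def)
    have "r * ((1 - x\<^sup>2) * u) = r * ((r + 1) * (T n - x * T (Suc n)))"
      using A B by algebra
    with \<open>r \<noteq> 0\<close> show ?thesis by simp
  qed
  with r0 have C: "(1 - x\<^sup>2) * u = (r + 1) * (T n - x * T (Suc n))"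
    by (metis add_nonneg_eq_0_iff mult_left_cancel zero_le_one zero_neq_one)
  have B2: "(r + 1) * x * T' (Suc (Suc n)) = (r + 2) * u + (r + 1) * (r + 2) * T (Suc (Suc n))"
    using A2 C T2 by algebra
  show ?case
    using A2 B2 by (simp add: u_def r_def algebra_simps)
qed

text \<open>Repeated differentiation of the case \<open>k = 0\<close>: each time the product with
  \<open>x\<close> yields one extra copy of the lower derivative, which turns \<open>n\<close> into
  \<open>n + k\<close>.\<close>

lemma cheb_deriv_rel_up:
  "real n * poly (cheb_deriv (Suc n) (Suc k)) x =
    (n + 1) * (x * poly (cheb_deriv n (Suc k)) x + (n + k) * poly (cheb_deriv n k) x)"
proof (induction k arbitrary: x)
  case 0
  show ?case using cheb_deriv_relations_0[of n x] by simp
next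
  case (Suc k)
  have "((\<lambda>x. real n * poly (cheb_deriv (Suc n) (Suc k)) x) has_real_derivative
      real n * poly (cheb_deriv (Suc n) (Suc (Suc k))) x) (at x)"
    by (auto intro!: derivative_eq_intros)
  moreover have "((\<lambda>x. real n * poly (cheb_deriv (Suc n) (Suc k)) x) has_real_derivative
      (n + 1) * (x * poly (cheb_deriv n (Suc (Suc k))) x + poly (cheb_deriv n (Suc k)) x
        + (n + k) * poly (cheb_deriv n (Suc k)) x)) (at x)"
    unfolding Suc.IH by (auto intro!: derivative_eq_intros simp: algebra_simps)
  ultimately have "real n * poly (cheb_deriv (Suc n) (Suc (Suc k))) x =
      (n + 1) * (x * poly (cheb_deriv n (Suc (Suc k))) x + poly (cheb_deriv n (Suc k)) x
        + (n + k) * poly (cheb_deriv n (Suc k)) x)"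
    by (rule DERIV_unique)
  then show ?case by (simp add: algebra_simps)
qed

text \<open>Here the factor \<open>x\<close> is on the left, so the extra copies are subtracted and
  \<open>n + 1\<close> becomes \<open>n + 1 - k\<close>.\<close>

lemma cheb_deriv_rel_down:
  "real n * x * poly (cheb_deriv (Suc n) (Suc k)) x =
    (n + 1) * poly (cheb_deriv n (Suc k)) x
    + n * (real n + 1 - k) * poly (cheb_deriv (Suc n) k) x"
proof (induction k arbitrary: x)
  case 0
  show ?case using conjunct2[OF cheb_deriv_relations_0[of n x]] by simp
next
  case (Suc k)
  have "((\<lambda>x. real n * x * poly (cheb_deriv (Suc n) (Suc k)) x) has_real_derivative
      real n * x * poly (cheb_deriv (Suc n) (Suc (Suc k))) x
      + real n * poly (cheb_deriv (Suc n) (Suc k)) x) (at x)"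
    by (auto intro!: derivative_eq_intros)
  moreover have "((\<lambda>x. real n * x * poly (cheb_deriv (Suc n) (Suc k)) x) has_real_derivative
      (n + 1) * poly (cheb_deriv n (Suc (Suc k))) x
      + n * (real n + 1 - k) * poly (cheb_deriv (Suc n) (Suc k)) x) (at x)"
    unfolding Suc.IH by (auto intro!: derivative_eq_intros simp: algebra_simps)
  ultimately have "real n * x * poly (cheb_deriv (Suc n) (Suc (Suc k))) x
      + real n * poly (cheb_deriv (Suc n) (Suc k)) x =
      (n + 1) * poly (cheb_deriv n (Suc (Suc k))) x
      + n * (real n + 1 - k) * poly (cheb_deriv (Suc n) (Suc k)) x"
    by (rule DERIV_unique)
  then show ?case by (simp add: algebra_simps)
qed

text \<open>The two relations above are linear in the derivatives of order \<open>k + 1\<close>.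
  Solving them, with a determinant proportional to \<open>1 - x^2\<close>, gives this equation and
  \<open>cheb_deriv_upper\<close>.\<close>

lemma cheb_deriv_lower:
  assumes "n \<ge> 1"
  shows "(1 - x\<^sup>2) * poly (cheb_deriv n (Suc k)) x =
    (n + k) * x * poly (cheb_deriv n k) x
    - n * (real n + 1 - k) / (n + 1) * poly (cheb_deriv (Suc n) k) x"
proof -
  have "(real n + 1) * ((1 - x\<^sup>2) * poly (cheb_deriv n (Suc k)) x) =
    (real n + 1) * ((n + k) * x * poly (cheb_deriv n k) x)
    - n * (real n + 1 - k) * poly (cheb_deriv (Suc n) k) x"
    using cheb_deriv_rel_up[of n k x] cheb_deriv_rel_down[of n x k]
    unfolding of_nat_add of_nat_1 by algebra
  then show ?thesis by (simp add: field_simps)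
qed

lemma cheb_deriv_upper:
  assumes "n \<ge> 1"
  shows "(1 - x\<^sup>2) * poly (cheb_deriv (Suc n) (Suc k)) x =
    (n + 1) * (real n + k) / n * poly (cheb_deriv n k) x
    - (real n + 1 - k) * x * poly (cheb_deriv (Suc n) k) x"
proof -
  have "real n * ((1 - x\<^sup>2) * poly (cheb_deriv (Suc n) (Suc k)) x) =
    (n + 1) * (real n + k) * poly (cheb_deriv n k) x
    - n * ((real n + 1 - k) * x * poly (cheb_deriv (Suc n) k) x)"
    using cheb_deriv_rel_up[of n k x] cheb_deriv_rel_down[of n x k]
    unfolding of_nat_add of_nat_1 by algebra
  then show ?thesis using assms by (simp add: field_simps)
qed

text \<open>The Chebyshev equation differentiated \<open>k\<close> times. It arises from
  \<open>cheb_deriv_lower\<close> at order \<open>k + 1\<close> when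
  \<open>cheb_deriv_rel_up\<close> eliminates the term of degree \<open>n + 1\<close>.\<close>

lemma cheb_deriv_ode:
  assumes "n \<ge> 1"
  shows "(1 - x\<^sup>2) * poly (cheb_deriv n (Suc (Suc k))) x =
    (2 * real k + 1) * x * poly (cheb_deriv n (Suc k)) x
    - ((real n)\<^sup>2 - (real k)\<^sup>2) * poly (cheb_deriv n k) x"
proof -
  have "real n / (n + 1) * poly (cheb_deriv (Suc n) (Suc k)) x =
      x * poly (cheb_deriv n (Suc k)) x + (n + k) * poly (cheb_deriv n k) x"
    using cheb_deriv_rel_up[of n k x] by (simp add: field_simps)
  then have "n * (real n - k) / (n + 1) * poly (cheb_deriv (Suc n) (Suc k)) x =
      (real n - k) * (x * poly (cheb_deriv n (Suc k)) x + (n + k) * poly (cheb_deriv n k) x)"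
    by (metis (no_types, opaque_lifting) mult.assoc mult.commute times_divide_eq_left)
  then show ?thesis
    using cheb_deriv_lower[OF assms, of x "Suc k"]
    by (simp add: algebra_simps power2_eq_square)
qed

section \<open>Signs for \<open>x \<ge> 1\<close> and vanishing of high derivatives\<close>

lemma cheb_ge_1: "x \<ge> 1 \<Longrightarrow> poly (cheb n) x \<ge> 1 \<and> poly (cheb (Suc n)) x \<ge> poly (cheb n) x"
proof (induction n)
  case (Suc n)
  then have "1 * (2 * poly (cheb (Suc n)) x) \<le> x * (2 * poly (cheb (Suc n)) x)"
    by (intro mult_right_mono) auto
  moreover have "poly (cheb (Suc (Suc n))) x = x * (2 * poly (cheb (Suc n)) x) - poly (cheb n) x"
    by simp
  ultimately show ?case using Suc by linarith
qed auto

lemma cheb_deriv_eq_0: "n < k \<Longrightarrow> cheb_deriv n k = 0"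
proof (induction n arbitrary: k)
  case 0
  then obtain j where "k = Suc j" by (cases k) auto
  moreover have "(pderiv ^^ j) 0 = (0 :: real poly)" for j
    by (induction j) auto
  ultimately show ?case by (simp add: cheb_deriv_def funpow_Suc_right del: funpow.simps)
next
  case (Suc n)
  then obtain j where k: "k = Suc j" "n < j" by (cases k) auto
  show ?case
  proof (cases "n = 0")
    case True
    with k obtain i where "k = Suc (Suc i)" by (cases j) auto
    moreover have "(pderiv ^^ j) 0 = (0 :: real poly)" for j
      by (induction j) auto
    ultimately show ?thesis using True
      by (simp add: cheb_deriv_def funpow_Suc_right pderiv_pCons del: funpow.simps)
  next
    case False
    have "real n * poly (cheb_deriv (Suc n) (Suc j)) x = 0" for x
      using cheb_deriv_rel_up[of n j x] Suc.IH[of j] Suc.IH[of "Suc j"] k by simp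
    with False k have "poly (cheb_deriv (Suc n) k) x = 0" for x by simp
    then show ?thesis by (simp add: poly_eq_poly_eq_iff[symmetric] fun_eq_iff)
  qed
qed

text \<open>For \<open>x \<ge> 1\<close> the right side of \<open>cheb_deriv_rel_up\<close> has
  nonnegative terms and a positive last one, so positivity passes to the next degree. Hence all real
  zeros lie left of 1.\<close>

lemma cheb_deriv_pos:
  assumes "x \<ge> 1" "k \<le> n"
  shows "poly (cheb_deriv n k) x > 0"
  using assms(2)
proof (induction n arbitrary: k)
  case 0
  then show ?case by simp
next
  case (Suc n)
  show ?case
  proof (cases k)
    case 0
    then show ?thesis using cheb_ge_1[OF assms(1), of "Suc n"] by simp
  next
    case (Suc j)
    show ?thesis
    proof (cases "n = 0")
      case True
      then show ?thesis using Suc Suc.prems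
        by (simp add: cheb_deriv_def pderiv_pCons)
    next
      case False
      have "poly (cheb_deriv n (Suc j)) x \<ge> 0"
        using Suc.IH[of "Suc j"] cheb_deriv_eq_0[of n "Suc j"] by (cases "Suc j \<le> n") auto
      moreover have "poly (cheb_deriv n j) x > 0"
        using Suc.IH[of j] Suc Suc.prems by auto
      ultimately have "0 < (n + 1) * (x * poly (cheb_deriv n (Suc j)) x
          + (n + j) * poly (cheb_deriv n j) x)"
        using assms(1) False by (intro mult_pos_pos add_nonneg_pos) auto
      also have "\<dots> = real n * poly (cheb_deriv (Suc n) k) x"
        using cheb_deriv_rel_up[of n j x] Suc by simp
      finally show ?thesis using False by (simp add: zero_less_mult_iff)
    qed
  qed
qed

subsection \<open>Rightmost critical points\<close>

lemma cheb_deriv_nonzero: "k \<le> n \<Longrightarrow> cheb_deriv n k \<noteq> 0"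
  using cheb_deriv_pos[of 1 k n] by auto

text \<open>Inside the interval the differential equation would propagate a double zero to all
  higher derivatives, but the one of order \<open>n\<close> is a nonzero constant.\<close>

lemma cheb_deriv_no_double_root:
  assumes "1 \<le> n" "k \<le> n" "\<bar>x\<bar> < 1" "poly (cheb_deriv n k) x = 0"
  shows "poly (cheb_deriv n (Suc k)) x \<noteq> 0"
proof
  assume "poly (cheb_deriv n (Suc k)) x = 0"
  then have "poly (cheb_deriv n (k + j)) x = 0 \<and> poly (cheb_deriv n (Suc (k + j))) x = 0" for j
  proof (induction j)
    case 0
    then show ?case using assms by simp
  next
    case (Suc j)
    have "(1 - x\<^sup>2) * poly (cheb_deriv n (Suc (Suc (k + j)))) x = 0"
      using Suc cheb_deriv_ode[of n x "k + j"] assms by simp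
    moreover have "x\<^sup>2 \<noteq> 1" using assms(3) by (auto simp: power2_eq_1_iff)
    ultimately show ?case using Suc by simp
  qed
  from this[of "n - k"] have "poly (cheb_deriv n n) x = 0" using assms by simp
  moreover have "pderiv (cheb_deriv n n) = 0"
    using cheb_deriv_eq_0[of n "Suc n"] by (simp add: pderiv_cheb_deriv)
  then obtain c where "cheb_deriv n n = [:c:]"
    by (metis pderiv_eq_0_iff degree_eq_zeroE)
  ultimately show False
    using cheb_deriv_pos[of 1 n n] by simp
qed

lemma poly_pos_right_of_roots:
  fixes p :: "real poly"
  assumes "poly p b > 0" "y < b" "\<And>x. y < x \<Longrightarrow> poly p x \<noteq> 0" "y < x"
  shows "poly p x > 0"
proof (rule ccontr)
  assume "\<not> poly p x > 0"
  with assms(3)[OF assms(4)] have neg: "poly p x < 0" by linarith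
  consider "x < b" | "b < x" using neg assms(1) by fastforce
  then show False
  proof cases
    case 1
    with poly_IVT_pos[OF 1 neg assms(1)] assms(3,4) show False by force
  next
    case 2
    with poly_IVT_neg[OF 2 assms(1) neg] assms(2,3) show False by force
  qed
qed

text \<open>Maximality is encoded as positivity to the right, the form the sign arguments use; the
  bounds on \<open>y\<close> ensure \<open>1 - x^2 > 0\<close> from \<open>y\<close> up to
  1.\<close>

definition rightmost_crit :: "nat \<Rightarrow> nat \<Rightarrow> real \<Rightarrow> bool" where
  "rightmost_crit n k y \<longleftrightarrow> 0 \<le> y \<and> y < 1 \<and> poly (cheb_deriv n (Suc k)) y = 0 \<and>
     (\<forall>x>y. poly (cheb_deriv n (Suc k)) x > 0)"

lemma omega_eqI:
  assumes "rightmost_crit n k y"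
  shows "omega n k = y"
proof -
  let ?S = "{x. poly (cheb_deriv n (Suc k)) x = 0}"
  have "cheb_deriv n (Suc k) \<noteq> 0"
    using assms unfolding rightmost_crit_def by (metis less_irrefl poly_0)
  then have "finite ?S" by (rule poly_roots_finite)
  then show ?thesis
    unfolding omega_def using assms
    by (intro Max_eqI) (force simp: rightmost_crit_def not_less[symmetric])+
qed

text \<open>A positive value would, by the differential equation, make the derivative decrease
  through zero at \<open>y\<close>, against its positivity to the right. A zero value would be a
  double zero.\<close>

lemma rightmost_crit_neg:
  assumes "rightmost_crit n k y" "Suc k \<le> n"
  shows "poly (cheb_deriv n k) y < 0"
proof -
  from assms(1) have y: "0 \<le> y" "y < 1" "poly (cheb_deriv n (Suc k)) y = 0"
    and pos: "\<And>x. x > y \<Longrightarrow> poly (cheb_deriv n (Suc k)) x > 0"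
    by (auto simp: rightmost_crit_def)
  have n: "n \<ge> 1" using assms(2) by simp
  have y2: "1 - y\<^sup>2 > 0" using y by (simp add: power_less_one_iff abs_square_less_1)
  have kn: "(real k)\<^sup>2 < (real n)\<^sup>2" using assms(2) by (simp add: power_strict_mono)
  have ne: "poly (cheb_deriv n k) y \<noteq> 0"
    using cheb_deriv_no_double_root[of n k y] y n assms(2) by auto
  show ?thesis
  proof (rule ccontr)
    assume "\<not> ?thesis"
    with ne have "poly (cheb_deriv n k) y > 0" by simp
    then have "(1 - y\<^sup>2) * poly (cheb_deriv n (Suc (Suc k))) y < 0"
      using cheb_deriv_ode[OF n, of y k] y(3) kn by simp
    then have "poly (cheb_deriv n (Suc (Suc k))) y < 0"
      using y2 by (simp add: mult_less_0_iff)
    moreover have "(poly (cheb_deriv n (Suc k)) has_real_derivative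
        poly (cheb_deriv n (Suc (Suc k))) y) (at y)"
      by (metis poly_DERIV pderiv_cheb_deriv)
    ultimately obtain d where "d > 0" "\<forall>h>0. h < d \<longrightarrow>
        poly (cheb_deriv n (Suc k)) (y + h) < poly (cheb_deriv n (Suc k)) y"
      using DERIV_neg_dec_right by blast
    then show False
      using pos[of "y + d / 2"] y(3) by (auto dest!: spec[of _ "d / 2"])
  qed
qed

text \<open>By \<open>cheb_deriv_rel_up\<close> and \<open>rightmost_crit_neg\<close> the new
  derivative is negative at \<open>y\<close>, while it is positive at 1; this puts \<open>z\<close>
  strictly between them.\<close>

lemma rightmost_crit_step:
  assumes "rightmost_crit n k y" "k + 2 \<le> n"
  obtains z where "rightmost_crit (Suc n) k z" "y < z"
    "\<And>x. y \<le> x \<Longrightarrow> x < z \<Longrightarrow> poly (cheb_deriv (Suc n) (Suc k)) x < 0"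
proof -
  let ?f = "cheb_deriv (Suc n) (Suc k)"
  from assms(1) have y: "0 \<le> y" "y < 1" "poly (cheb_deriv n (Suc k)) y = 0"
    and pos: "\<And>x. x > y \<Longrightarrow> poly (cheb_deriv n (Suc k)) x > 0"
    by (auto simp: rightmost_crit_def)
  have "real n * poly ?f y < 0"
    using cheb_deriv_rel_up[of n k y] rightmost_crit_neg[OF assms(1)] y assms(2)
    by (auto simp: mult_less_0_iff intro!: mult_pos_neg)
  then have fy: "poly ?f y < 0" by (simp add: mult_less_0_iff)
  have f1: "poly ?f x > 0" if "x \<ge> 1" for x
    using cheb_deriv_pos[of x "Suc k" "Suc n"] assms(2) that by simp
  let ?S = "{x. poly ?f x = 0}"
  have fin: "finite ?S"
    using cheb_deriv_nonzero[of "Suc k" "Suc n"] assms(2) by (intro poly_roots_finite) auto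
  obtain w where w: "y < w" "poly ?f w = 0"
    using poly_IVT_pos[OF y(2) fy f1[of 1]] by auto
  define z where "z = Max ?S"
  have zS: "poly ?f z = 0" using Max_in[OF fin] w unfolding z_def by blast
  have zmax: "x \<le> z" if "poly ?f x = 0" for x
    using Max_ge[OF fin] that unfolding z_def by blast
  have yz: "y < z" using w zmax by force
  have z1: "z < 1" using f1[of z] zS by force
  have "poly ?f x > 0" if "x > z" for x
    by (rule poly_pos_right_of_roots[OF f1[of 1] z1 _ that]) (use zmax in force)+
  then have crit: "rightmost_crit (Suc n) k z"
    using zS z1 yz y by (auto simp: rightmost_crit_def)
  \<comment> \<open>To the right of \<open>y\<close> every zero of \<open>f\<close> is an upcrossing, so there is only one.\<close>
  have up: "poly (cheb_deriv (Suc n) (Suc (Suc k))) x > 0"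
    if "y < x" "x < 1" "poly ?f x = 0" for x
  proof -
    \<comment> \<open>At a zero of \<open>f\<close> this relation forces the derivative of order
      \<open>k\<close> to be negative, and the differential equation then makes the next derivative
      positive.\<close>
    have "(real n + 1) * poly (cheb_deriv n (Suc k)) x
        + n * (real n + 1 - k) * poly (cheb_deriv (Suc n) k) x = 0"
      using cheb_deriv_rel_down[of n x k] that by simp
    moreover have "(real n + 1) * poly (cheb_deriv n (Suc k)) x > 0"
      using pos[OF that(1)] by simp
    ultimately have "n * (real n + 1 - k) * poly (cheb_deriv (Suc n) k) x < 0" by linarith
    moreover have "n * (real n + 1 - k) > 0" using assms(2) by simp
    ultimately have neg: "poly (cheb_deriv (Suc n) k) x < 0"
      by (meson less_asym' mult_less_0_iff)
    have "(real k)\<^sup>2 < (real (Suc n))\<^sup>2" using assms(2) by (intro power_strict_mono) auto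
    then have "((real (Suc n))\<^sup>2 - (real k)\<^sup>2) * poly (cheb_deriv (Suc n) k) x < 0"
      using neg by (simp add: mult_less_0_iff del: of_nat_Suc)
    then have "(1 - x\<^sup>2) * poly (cheb_deriv (Suc n) (Suc (Suc k))) x > 0"
      using cheb_deriv_ode[of "Suc n" x k] that(3) by simp
    moreover have "1 - x\<^sup>2 > 0" using that y by (simp add: abs_square_less_1)
    ultimately show ?thesis by (simp add: zero_less_mult_iff)
  qed
  have der: "(poly ?f has_real_derivative poly (cheb_deriv (Suc n) (Suc (Suc k))) x) (at x)" for x
    by (metis poly_DERIV pderiv_cheb_deriv)
  have no_root: "poly ?f x \<noteq> 0" if "y \<le> x" "x < z" for x
  proof
    assume "poly ?f x = 0"
    let ?R = "{x. poly ?f x = 0 \<and> x < z}"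
    \<comment> \<open>The last zero before \<open>z\<close>. As \<open>r\<close> and
      \<open>z\<close> are both upcrossings, \<open>f\<close> changes sign between
      \<open>r + h\<close> and \<open>z - h\<close>, which yields a later zero; dividing by 3 below
      keeps these points in order.\<close>
    define r where "r = Max ?R"
    have finR: "finite ?R" using fin by (rule rev_finite_subset) auto
    have xR: "x \<in> ?R" using that \<open>poly ?f x = 0\<close> by auto
    have r: "poly ?f r = 0" "r < z" using Max_in[OF finR] xR unfolding r_def by blast+
    have rmax: "v \<le> r" if "poly ?f v = 0" "v < z" for v
      using Max_ge[OF finR] that unfolding r_def by blast
    have "x \<le> r" using rmax that \<open>poly ?f x = 0\<close> by auto
    with that have "y \<le> r" by simp
    with fy r have yr: "y < r" by (cases "y = r") auto
    obtain d1 where d1: "d1 > 0" "\<And>h. 0 < h \<Longrightarrow> h < d1 \<Longrightarrow> poly ?f (r + h) > 0"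
      using DERIV_pos_inc_right[OF der up[OF yr _ r(1)]] r z1 by auto
    obtain d2 where d2: "d2 > 0" "\<And>h. 0 < h \<Longrightarrow> h < d2 \<Longrightarrow> poly ?f (z - h) < 0"
      using DERIV_pos_inc_left[OF der up[OF yz z1 zS]] zS by auto
    define h where "h = Min {d1, d2, z - r} / 3"
    have h: "0 < h" "h < d1" "h < d2" "r + h < z - h"
      using d1(1) d2(1) r(2) by (auto simp: h_def min_def field_simps)
    from poly_IVT_neg[OF h(4) d1(2)[OF h(1,2)] d2(2)[OF h(1,3)]]
    obtain v where "r + h < v" "v < z - h" "poly ?f v = 0" by auto
    with rmax[of v] h(1) show False by auto
  qed
  have "poly ?f x < 0" if "y \<le> x" "x < z" for x
  proof (rule ccontr)
    assume "\<not> ?thesis"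
    with no_root[OF that] have "poly ?f x > 0" by simp
    with fy that(1) have "y < x" by (cases "y = x") auto
    from poly_IVT_pos[OF this fy \<open>poly ?f x > 0\<close>] no_root that show False by force
  qed
  with crit yz that show ?thesis by blast
qed

subsection \<open>Monotonicity in the degree\<close>

lemma tau_step:
  assumes crit: "rightmost_crit n k y" and n: "k + 2 \<le> n"
  shows "tau (Suc n) k \<le> tau n k"
proof -
  obtain z where crit': "rightmost_crit (Suc n) k z" and yz: "y < z"
    and neg: "\<And>x. y \<le> x \<Longrightarrow> x < z \<Longrightarrow> poly (cheb_deriv (Suc n) (Suc k)) x < 0"
    using rightmost_crit_step[OF crit n] by blast
  define c where "c = poly (cheb_deriv n k) 1"
  define d where "d = poly (cheb_deriv (Suc n) k) 1"
  have c: "c > 0" and d: "d > 0"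
    using n by (auto simp: c_def d_def intro!: cheb_deriv_pos)
  define M where "M = real n + k"
  define N where "N = real n + 1 - k"
  have M: "M > 0" and N: "N > 0" and n0: "real n > 0" using n by (auto simp: M_def N_def)
  \<comment> \<open>At \<open>x = 1\<close> the derivative drops out of
    \<open>cheb_deriv_lower\<close>. The resulting ratio of normalising constants reduces the
    coefficients in \<open>ea\<close> and \<open>eb\<close> to \<open>M\<close> and
    \<open>N\<close>.\<close>
  have cd: "n * N * d = (real n + 1) * M * c"
    using cheb_deriv_lower[of n 1 k] n by (simp add: c_def d_def M_def N_def field_simps)
  define a where "a x = poly (cheb_deriv n k) x / c" for x
  define b where "b x = poly (cheb_deriv (Suc n) k) x / d" for x
  define a' where "a' x = poly (cheb_deriv n (Suc k)) x / c" for x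
  define b' where "b' x = poly (cheb_deriv (Suc n) (Suc k)) x / d" for x
  have da: "(a has_real_derivative a' x) (at x)" for x
    unfolding a_def [abs_def] a'_def using c by (auto intro!: derivative_eq_intros)
  have db: "(b has_real_derivative b' x) (at x)" for x
    unfolding b_def [abs_def] b'_def using d by (auto intro!: derivative_eq_intros)
  have ea: "(1 - x\<^sup>2) * a' x = M * (x * a x - b x)" for x
  proof -
    have "(1 - x\<^sup>2) * a' x = M * x * a x - n * N / (real n + 1) * (d * b x) / c"
      using cheb_deriv_lower[of n x k] n c d
      by (simp add: a_def b_def a'_def M_def N_def diff_divide_distrib)
    also have "n * N / (real n + 1) * (d * b x) / c = (n * N * d) * b x / ((real n + 1) * c)"
      by simp
    also have "\<dots> = M * b x" unfolding cd
      by (subst nonzero_divide_eq_eq) (use c n0 in \<open>simp_all add: mult_ac\<close>)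
    finally show ?thesis by (simp add: algebra_simps)
  qed
  have eb: "(1 - x\<^sup>2) * b' x = N * (a x - x * b x)" for x
  proof -
    have "(1 - x\<^sup>2) * b' x = (n + 1) * M / n * (c * a x) / d - N * x * b x"
      using cheb_deriv_upper[of n x k] n c d
      by (simp add: a_def b_def b'_def M_def N_def diff_divide_distrib)
    also have "(n + 1) * M / n * (c * a x) / d = ((real n + 1) * M * c) * a x / (n * d)"
      by simp
    also have "\<dots> = N * a x" unfolding cd[symmetric] using d n0 by (simp add: field_simps)
    finally show ?thesis by (simp add: algebra_simps)
  qed
  \<comment> \<open>The quadratic form \<open>D\<close> interpolates between the squares of the two extrema:
    \<open>b = x a\<close> at \<open>y\<close> and \<open>a = x b\<close> at \<open>z\<close>.\<close>
  define D where "D x = ((a x)\<^sup>2 - 2 * x * a x * b x + (b x)\<^sup>2) / (1 - x\<^sup>2)" for x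
  from crit crit' have y: "0 \<le> y" "y < 1" "a' y = 0" and z: "0 \<le> z" "z < 1" "b' z = 0"
    by (auto simp: rightmost_crit_def a'_def b'_def)
  have sq: "1 - x\<^sup>2 > 0" if "0 \<le> x" "x < 1" for x :: real
    using that by (simp add: abs_square_less_1)
  have dD: "(D has_real_derivative
      4 * real k * ((x * a x - b x) * (a x - x * b x)) / (1 - x\<^sup>2)\<^sup>2) (at x)"
    if "0 \<le> x" "x < 1" for x
  proof -
    define w where "w = 1 - x\<^sup>2"
    have w: "w > 0" using sq[OF that] by (simp add: w_def)
    have a'x: "a' x * w = M * (x * a x - b x)" and b'x: "b' x * w = N * (a x - x * b x)"
      using ea[of x] eb[of x] by (simp_all add: w_def mult.commute)
    have MN: "M = 2 * real k - 1 + N" by (simp add: M_def N_def)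
    let ?G = "(a x)\<^sup>2 - 2 * x * a x * b x + (b x)\<^sup>2"
    have "(D has_real_derivative
       ((2 * a x * a' x - 2 * a x * b x - 2 * x * a' x * b x - 2 * x * a x * b' x + 2 * b x * b' x)
         * w + ?G * (2 * x)) / w\<^sup>2) (at x)"
      unfolding D_def [abs_def] using w
      by (auto intro!: derivative_eq_intros da db simp: w_def power2_eq_square algebra_simps)
    also have "(2 * a x * a' x - 2 * a x * b x - 2 * x * a' x * b x - 2 * x * a x * b' x + 2 * b x * b' x)
         * w + ?G * (2 * x) =
       2 * (a' x * w) * (a x - x * b x) - 2 * (b' x * w) * (x * a x - b x) - 2 * a x * b x * w + ?G * (2 * x)"
      by (simp add: algebra_simps)
    \<comment> \<open>With \<open>p = x a - b\<close> and \<open>q = a - x b\<close>, the first two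
      terms give \<open>2 (M - N) p q\<close> and the others \<open>2 p q\<close>; here
      \<open>M - N = 2 k - 1\<close>.\<close>
    also have "\<dots> = 4 * real k * ((x * a x - b x) * (a x - x * b x))"
      using a'x b'x MN w_def by algebra
    finally show ?thesis by (simp add: w_def)
  qed
  have "D z \<le> D y"
  proof (rule DERIV_nonpos_imp_nonincreasing[of y z D])
    show "y \<le> z" using yz by simp
    fix x assume x: "y \<le> x" "x \<le> z"
    with y z have x01: "0 \<le> x" "x < 1" by auto
    \<comment> \<open>The strict signs of \<open>a'\<close> and \<open>b'\<close> fail only at
      \<open>y\<close> and \<open>z\<close> respectively, where these derivatives vanish.\<close>
    have "a' x \<ge> 0" using crit x c y(3) by (cases "x = y") (auto simp: a'_def rightmost_crit_def less_imp_le)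
    then have "M * (x * a x - b x) \<ge> 0" using ea[of x] sq[OF x01] by (metis mult_nonneg_nonneg less_imp_le)
    then have 1: "x * a x - b x \<ge> 0" using M by (simp add: zero_le_mult_iff)
    have "b' x \<le> 0" using neg[of x] x d z(3)
      by (cases "x = z") (auto simp: b'_def divide_le_0_iff less_imp_le)
    then have "N * (a x - x * b x) \<le> 0" using eb[of x] sq[OF x01] by (metis mult_nonneg_nonpos less_imp_le)
    then have 2: "a x - x * b x \<le> 0" using N by (simp add: mult_le_0_iff)
    have "4 * real k * ((x * a x - b x) * (a x - x * b x)) / (1 - x\<^sup>2)\<^sup>2 \<le> 0"
      using mult_nonneg_nonpos[OF 1 2] by (simp add: divide_le_0_iff mult_le_0_iff)
    with dD[OF x01] show "\<exists>y. (D has_real_derivative y) (at x) \<and> y \<le> 0" by blast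
  qed
  moreover have "D y = (a y)\<^sup>2"
  proof -
    have "b y = y * a y" using ea[of y] y M by simp
    then show ?thesis using sq[OF y(1,2)] by (simp add: D_def field_simps power2_eq_square)
  qed
  moreover have "D z = (b z)\<^sup>2"
  proof -
    have "a z = z * b z" using eb[of z] z N by simp
    then show ?thesis using sq[OF z(1,2)] by (simp add: D_def field_simps power2_eq_square)
  qed
  ultimately have "\<bar>b z\<bar> \<le> \<bar>a y\<bar>" by (simp add: abs_le_square_iff)
  then show ?thesis
    using c d unfolding tau_def omega_eqI[OF crit] omega_eqI[OF crit']
    by (simp add: a_def b_def c_def[symmetric] d_def[symmetric])
qed

subsection \<open>Gegenbauer polynomials and explicit extrema\<close>

text \<open>Up to a factor depending only on k, the k-th derivative of T_(k+m) is k + m times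
  the Gegenbauer polynomial of degree m and parameter k.\<close>
fun gegenbauer :: "real \<Rightarrow> nat \<Rightarrow> real \<Rightarrow> real" where
  "gegenbauer l 0 x = 1"
| "gegenbauer l (Suc 0) x = 2 * l * x"
| "gegenbauer l (Suc (Suc m)) x =
    (2 * (l + m + 1) * x * gegenbauer l (Suc m) x - (2 * l + m) * gegenbauer l m x) / (real m + 2)"

text \<open>Both \<open>cheb_deriv_lower\<close> at degree \<open>n + 1\<close> and
  \<open>cheb_deriv_upper\<close> at degree \<open>n\<close> express the same derivative; equating
  them leaves a recurrence in the degree alone. At \<open>n = k + m\<close> it is a rescaled
  Gegenbauer recurrence.\<close>

lemma cheb_deriv_three_term:
  assumes "n \<ge> 1"
  shows "n * (real n + 2 - k) * poly (cheb_deriv (n + 2) k) x =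
    (real n + 2) * (2 * real n * x * poly (cheb_deriv (Suc n) k) x - (real n + k) * poly (cheb_deriv n k) x)"
proof -
  define N where "N = real n"
  have N: "N > 0" using assms by (simp add: N_def)
  have "(N + 1 + k) * x * poly (cheb_deriv (Suc n) k) x
    - (N + 1) * (N + 2 - k) / (N + 2) * poly (cheb_deriv (n + 2) k) x
    = (N + 1) * (N + k) / N * poly (cheb_deriv n k) x
    - (N + 1 - k) * x * poly (cheb_deriv (Suc n) k) x"
    using cheb_deriv_lower[of "Suc n" x k] cheb_deriv_upper[OF assms, of x k]
    by (simp add: N_def algebra_simps)
  then have "(N + 1) * ((N + 2 - k) / (N + 2) * poly (cheb_deriv (n + 2) k) x)
    = (N + 1) * (2 * x * poly (cheb_deriv (Suc n) k) x - (N + k) / N * poly (cheb_deriv n k) x)"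
    by (simp add: algebra_simps)
  then have "(N + 2 - k) / (N + 2) * poly (cheb_deriv (n + 2) k) x
    = 2 * x * poly (cheb_deriv (Suc n) k) x - (N + k) / N * poly (cheb_deriv n k) x"
    by (rule mult_left_cancel[THEN iffD1, rotated]) (use N in simp)
  then show ?thesis unfolding N_def[symmetric] using N by (simp add: field_simps)
qed

text \<open>The point is that \<open>c\<close> depends on neither \<open>m\<close> nor
  \<open>x\<close>, so it cancels in \<open>tau\<close>.\<close>

lemma cheb_deriv_gegenbauer:
  assumes "k \<ge> 1"
  obtains c where "c > 0"
    "\<And>m x. poly (cheb_deriv (k + m) k) x = c * (real k + m) * gegenbauer k m x"
proof -
  have "pderiv (cheb_deriv k k) = 0"
    using cheb_deriv_eq_0[of k "Suc k"] by (simp add: pderiv_cheb_deriv)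
  then obtain c where c: "cheb_deriv k k = [:c:]"
    by (metis pderiv_eq_0_iff degree_eq_zeroE)
  with cheb_deriv_pos[of 1 k k] have "c > 0" by simp
  have "poly (cheb_deriv (k + m) k) x = c / k * (real k + m) * gegenbauer k m x" for m x
  proof (induction "real k" m x rule: gegenbauer.induct)
    case (1 x)
    then show ?case using c assms by simp
  next
    case (2 x)
    \<comment> \<open>The derivative of order \<open>k + 1\<close> of \<open>T_k\<close> vanishes,
      so \<open>cheb_deriv_lower\<close> determines this one.\<close>
    have "k * poly (cheb_deriv (Suc k) k) x = 2 * k * (k + 1) * x * c"
      using cheb_deriv_lower[OF assms, of x k] c cheb_deriv_eq_0[of k "Suc k"] by (simp add: field_simps)
    then show ?case using assms by (simp add: field_simps)
  next
    case (3 m x)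
    define N where "N = real k + m"
    define e where "e = c / k"
    define g where "g i = gegenbauer k i x" for i
    have N: "N > 0" using assms by (simp add: N_def)
    have g: "(real m + 2) * g (Suc (Suc m)) = 2 * (N + 1) * x * g (Suc m) - (N + k) * g m"
      by (simp add: g_def N_def field_simps)
    have IH: "poly (cheb_deriv (k + m) k) x = e * N * g m"
      "poly (cheb_deriv (k + Suc m) k) x = e * (N + 1) * g (Suc m)"
      using 3 by (simp_all add: e_def N_def g_def)
    have "N * (real m + 2) * poly (cheb_deriv (k + Suc (Suc m)) k) x =
      (N + 2) * (2 * N * x * poly (cheb_deriv (k + Suc m) k) x
        - (N + k) * poly (cheb_deriv (k + m) k) x)"
      using cheb_deriv_three_term[of "k + m" k x] assms by (simp add: N_def)
    also have "\<dots> = N * (real m + 2) * (e * (N + 2) * g (Suc (Suc m)))"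
      unfolding IH using g by algebra
    finally have "poly (cheb_deriv (k + Suc (Suc m)) k) x = e * (N + 2) * g (Suc (Suc m))"
      by (rule mult_left_cancel[THEN iffD1, rotated]) (use N in simp)
    then show ?case by (simp add: e_def N_def g_def del: gegenbauer.simps)
  qed
  with that[of "c / k"] \<open>c > 0\<close> assms show thesis by simp
qed

text \<open>Critical points belong to derivative order \<open>k + 1\<close>: the parameter rises to
  \<open>k + 1\<close> and the degree is one less than for the values in
  \<open>tau_gegenbauer\<close>.\<close>

lemma rightmost_crit_gegenbauer:
  assumes "0 \<le> y" "y < 1" "gegenbauer (Suc k) m y = 0" "\<And>x. x > y \<Longrightarrow> gegenbauer (Suc k) m x > 0"
  shows "rightmost_crit (Suc k + m) k y"
proof -
  obtain c where c: "c > 0"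
    "\<And>m x. poly (cheb_deriv (Suc k + m) (Suc k)) x = c * (real (Suc k) + m) * gegenbauer (Suc k) m x"
    using cheb_deriv_gegenbauer[of "Suc k"] by auto
  show ?thesis
    using assms c(1) unfolding rightmost_crit_def c(2) by (auto intro!: mult_pos_pos)
qed

lemma tau_gegenbauer:
  assumes "rightmost_crit (k + m) k y" "k \<ge> 1"
  shows "tau (k + m) k = \<bar>gegenbauer k m y\<bar> / gegenbauer k m 1"
proof -
  obtain c where c: "c > 0"
    "\<And>m x. poly (cheb_deriv (k + m) k) x = c * (real k + m) * gegenbauer k m x"
    using cheb_deriv_gegenbauer[OF assms(2)] by auto
  have "\<bar>C * g\<bar> / (C * h) = \<bar>g\<bar> / h" if "C > 0" for C g h :: real
    using that by (simp add: abs_mult)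
  moreover have "c * (real k + m) > 0" using c(1) assms(2) by simp
  ultimately show ?thesis
    unfolding tau_def omega_eqI[OF assms(1)] c(2) by blast
qed

section \<open>Existence of critical points and descent in the degree\<close>

lemma rightmost_crit_exists:
  assumes "k + 2 \<le> n"
  shows "\<exists>y. rightmost_crit n k y"
  using assms
proof (induction n rule: dec_induct)
  case base
  \<comment> \<open>For \<open>n = k + 2\<close> the derivative is a positive multiple of
    \<open>x\<close>.\<close>
  show ?case using rightmost_crit_gegenbauer[of 0 k 1] by auto
next
  case (step n)
  then show ?case by (metis rightmost_crit_step)
qed

lemma tau_antimono:
  assumes "k + 2 \<le> m" "m \<le> n"
  shows "tau n k \<le> tau m k"
  using assms(2)
proof (induction n rule: dec_induct)
  case (step n)
  obtain y where "rightmost_crit n k y"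
    using rightmost_crit_exists[of k n] assms(1) step by auto
  from tau_step[OF this] show ?case using step assms(1) by linarith
qed simp

section \<open>Closed forms for degrees \<open>k + 5\<close> and \<open>k + 6\<close>\<close>

lemma gegenbauer_4:
  "gegenbauer l 4 x = l * (l + 1) / 6 * (4 * (l + 2) * (l + 3) * x ^ 4 - 12 * (l + 2) * x\<^sup>2 + 3)"
  by (simp add: eval_nat_numeral field_simps)

lemma gegenbauer_5:
  "gegenbauer l 5 x = l * (l + 1) * (l + 2) / 15 *
    (x * (4 * (l + 3) * (l + 4) * x ^ 4 - 20 * (l + 3) * x\<^sup>2 + 15))"
  by (simp add: eval_nat_numeral field_simps)

lemma gegenbauer_6:
  "gegenbauer l 6 x = l * (l + 1) * (l + 2) / 90 *
    (8 * (l + 3) * (l + 4) * (l + 5) * x ^ 6 - 60 * (l + 3) * (l + 4) * x ^ 4 + 90 * (l + 3) * x\<^sup>2 - 15)"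
  by (simp add: eval_nat_numeral field_simps)

lemma less_sqrt_imp_less_square: "0 \<le> X \<Longrightarrow> sqrt X < x \<Longrightarrow> X < x\<^sup>2"
  by (metis real_sqrt_less_iff real_sqrt_abs abs_ge_self order.strict_trans2)

text \<open>With s one of these parameters, the squares of the critical points are
  (3 + s) / (2 (k + 4)) for degree k + 5 and (5 + s) / (2 (k + 5)) for degree k + 6,
  and k is a rational function of the square of s.\<close>
definition alpha_param :: "nat \<Rightarrow> real" where
  "alpha_param k = sqrt (6 - 3 / (real k + 3))"

definition beta_param :: "nat \<Rightarrow> real" where
  "beta_param k = sqrt (10 - 15 / (real k + 4))"

text \<open>Vieta in the variable \<open>x^2\<close>; for \<open>Y < X\<close> and
  \<open>A > 0\<close> the factored form shows positivity beyond the root \<open>X\<close>.\<close>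

lemma biquadratic_factor:
  fixes A B C X Y x :: real
  assumes "A * (X + Y) = B" "A * (X * Y) = C"
  shows "A * x ^ 4 - B * x\<^sup>2 + C = A * ((x\<^sup>2 - X) * (x\<^sup>2 - Y))"
  unfolding assms[symmetric] by (simp add: algebra_simps eval_nat_numeral)

lemma alpha_eq:
  assumes "k \<ge> 1"
  defines "s \<equiv> alpha_param k"
  shows "alpha k = sqrt ((3 + s) / 8) * ((3 + s) / (2 + s))"
proof -
  define K where "K = real k"
  have K: "K \<ge> 1" using assms by (simp add: K_def)
  have le: "3 / (K + 3) \<le> 3 / 4" using K by (intro divide_left_mono) auto
  then have s2: "s\<^sup>2 = 6 - 3 / (K + 3)"
    by (simp add: s_def alpha_param_def K_def)
  have s: "s\<^sup>2 * (K + 3) = 6 * K + 15"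
    using K unfolding s2 by (simp add: field_simps)
  have s0: "s \<ge> 0" using le by (simp add: s_def alpha_param_def K_def)
  have "3 / (K + 3) > 0" using K by simp
  \<comment> \<open>The upper bound makes \<open>Y\<close> positive; the lower one gives the sign
    \<open>S\<close>.\<close>
  then have "s\<^sup>2 < 9" "4 < s\<^sup>2" using s2 le by linarith+
  then have s23: "2 < s" "s < 3"
    using s0 power_less_imp_less_base[of s 2 3] power_less_imp_less_base[of 2 2 s] by simp_all
  \<comment> \<open>\<open>X\<close> and \<open>Y\<close> are the roots of
    \<open>4 (K + 3) (K + 4) u^2 - 12 (K + 3) u + 3\<close>, and \<open>s\<close> is the root of its
    normalised discriminant.\<close>
  define X where "X = (3 + s) / (2 * (K + 4))"
  define Y where "Y = (3 - s) / (2 * (K + 4))"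
  have "Y < X" unfolding X_def Y_def using s23 K by (intro divide_strict_right_mono) auto
  moreover have "0 < X" "0 < Y" "X < 1" using s23 K by (auto simp: X_def Y_def)
  ultimately have XY: "0 < X" "0 < Y" "Y < X" "X < 1" by blast+
  have "X + Y = 3 / (K + 4)"
    unfolding X_def Y_def add_divide_distrib[symmetric] using K by (simp add: divide_simps)
  then have sum: "4 * (K + 3) * (K + 4) * (X + Y) = 12 * (K + 3)"
    using K by simp
  have "2 * (K + 4) * X = 3 + s" "2 * (K + 4) * Y = 3 - s"
    using K by (simp_all add: X_def Y_def)
  then have "X * Y * (4 * (K + 4)\<^sup>2) = 9 - s\<^sup>2" by algebra
  moreover have "(9 - s\<^sup>2) * (K + 3) = 3 * (K + 4)" using s by (simp add: algebra_simps)
  ultimately have "(K + 4) * (4 * (K + 3) * (K + 4) * (X * Y)) = (K + 4) * 3"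
    by algebra
  then have prod: "4 * (K + 3) * (K + 4) * (X * Y) = 3"
    by (rule mult_left_cancel[THEN iffD1, rotated]) (use K in simp)
  define w where "w = sqrt X"
  have w: "0 < w" "w < 1" "w\<^sup>2 = X" using XY by (auto simp: w_def)
  have w4: "w ^ 4 = X\<^sup>2" using w(3) by (metis numeral_Bit0 mult_2 power_add power2_eq_square)
  have g4: "gegenbauer (Suc k) 4 x = (K + 1) * (K + 2) / 6 *
      (4 * (K + 3) * (K + 4) * ((x\<^sup>2 - X) * (x\<^sup>2 - Y)))" for x
    using biquadratic_factor[OF sum prod, of x] unfolding gegenbauer_4
    by (simp add: K_def add_ac)
  have crit: "rightmost_crit (k + 5) k w"
  proof -
    have "gegenbauer (Suc k) 4 x > 0" if "w < x" for x
    proof -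
      have "X < x\<^sup>2" using that XY less_sqrt_imp_less_square[of X x] by (simp add: w_def)
      then show ?thesis unfolding g4 using K XY by (intro mult_pos_pos) auto
    qed
    then show ?thesis
      using rightmost_crit_gegenbauer[of w k 4] w g4[of w] by (simp add: add.commute[of k])
  qed
  \<comment> \<open>The brackets of \<open>gegenbauer (Suc k) 4\<close> and
    \<open>gegenbauer k 5\<close> have the same leading coefficient, so the equation for
    \<open>X\<close> makes the latter linear in \<open>X\<close>.\<close>
  have "4 * (K + 3) * (K + 4) * X\<^sup>2 = 12 * (K + 3) * X - 3"
    using biquadratic_factor[OF sum prod, of w] w w4 by simp
  then have "4 * (K + 3) * (K + 4) * w ^ 4 - 20 * (K + 3) * w\<^sup>2 + 15 = 12 - 8 * (K + 3) * X"
    using w w4 by (simp add: algebra_simps)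
  also have "\<dots> = - (4 * (s * (K + 3) - 3) / (K + 4))"
    using K by (simp add: X_def field_simps)
  finally have g5: "gegenbauer k 5 w = K * (K + 1) * (K + 2) / 15 * (w * - (4 * (s * (K + 3) - 3) / (K + 4)))"
    unfolding gegenbauer_5 K_def[symmetric] by simp
  have "s * (K + 3) \<ge> 2 * 4" using s23 K by (intro mult_mono) auto
  then have S: "s * (K + 3) - 3 > 0" by simp
  \<comment> \<open>Substituting \<open>s^2 (K + 3) = 6 K + 15\<close> after clearing denominators
    trades the dependence on \<open>K\<close> for \<open>s\<close>.\<close>
  have key: "(s * (K + 3) - 3) / (2 * K + 3) = (3 + s) / (2 + s)"
    using s K s23 by (simp add: field_simps power2_eq_square)
  have g51: "gegenbauer k 5 1 = K * (K + 1) * (K + 2) / 15 * ((2 * K + 1) * (2 * K + 3))"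
    unfolding gegenbauer_5 K_def[symmetric] by (simp add: algebra_simps)
  have cancel: "\<bar>c * (w * - e)\<bar> / (c * f) = w * e / f" if "c > 0" "e > 0" for c e f :: real
    using that w(1) by (simp add: abs_mult)
  have "tau (k + 5) k = w * (4 * (s * (K + 3) - 3) / (K + 4)) / ((2 * K + 1) * (2 * K + 3))"
    unfolding tau_gegenbauer[OF crit assms(1)] g5 g51 by (rule cancel) (use K S w in auto)
  also have "\<dots> = 4 * w / ((K + 4) * (2 * K + 1)) * ((s * (K + 3) - 3) / (2 * K + 3))"
    by (simp only: times_divide_times_eq times_divide_eq_right divide_divide_eq_left mult_ac)
  finally have tau: "tau (k + 5) k = 4 * w / ((K + 4) * (2 * K + 1)) * ((3 + s) / (2 + s))"
    unfolding key .
  have pw: "((K + 4) / 4) powr (3/2) = (K + 4) / 4 * sqrt ((K + 4) / 4)"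
    using K powr_add[of "(K + 4) / 4" 1 "1/2"] by (simp add: powr_half_sqrt)
  have cancel': "4 * w / (a * b) * t * b * (a / 4 * r) = w * r * t"
    if "a > 0" "b > 0" for a b r t :: real
    using that by (simp add: field_simps)
  have "alpha k = w * sqrt ((K + 4) / 4) * ((3 + s) / (2 + s))"
    unfolding alpha_def tau K_def[symmetric] pw by (rule cancel') (use K in simp_all)
  \<comment> \<open>The half power in the normalisation cancels the factor \<open>K + 4\<close> in
    \<open>X\<close>.\<close>
  also have "w * sqrt ((K + 4) / 4) = sqrt ((3 + s) / 8)"
    unfolding w_def X_def real_sqrt_mult[symmetric] using K by (simp add: field_simps)
  finally show ?thesis .
qed

text \<open>As in \<open>alpha_eq\<close>; the quintic for the critical points is odd, so its
  positive zeros again solve a biquadratic.\<close>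

lemma beta_eq:
  assumes "k \<ge> 1"
  defines "s \<equiv> beta_param k"
  shows "beta k = 2 * (5 + s)\<^sup>2 / (25 * (2 + s))"
proof -
  define K where "K = real k"
  have K: "K \<ge> 1" using assms by (simp add: K_def)
  have le: "15 / (K + 4) \<le> 15 / 5" using K by (intro divide_left_mono) auto
  then have s2: "s\<^sup>2 = 10 - 15 / (K + 4)"
    by (simp add: s_def beta_param_def K_def)
  have s: "s\<^sup>2 * (K + 4) = 10 * K + 25"
    using K unfolding s2 by (simp add: field_simps)
  have s0: "s \<ge> 0" using le by (simp add: s_def beta_param_def K_def)
  have "15 / (K + 4) > 0" using K by simp
  then have "s\<^sup>2 < 16" "4 < s\<^sup>2" using s2 le by linarith+
  then have s24: "2 < s" "s < 4"
    using s0 power_less_imp_less_base[of s 2 4] power_less_imp_less_base[of 2 2 s] by simp_all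
  \<comment> \<open>Roots of \<open>4 (K + 4) (K + 5) u^2 - 20 (K + 4) u + 15\<close>.\<close>
  define X where "X = (5 + s) / (2 * (K + 5))"
  define Y where "Y = (5 - s) / (2 * (K + 5))"
  have "Y < X" unfolding X_def Y_def using s24 K by (intro divide_strict_right_mono) auto
  moreover have "0 < X" "0 < Y" "X < 1" using s24 K by (auto simp: X_def Y_def)
  ultimately have XY: "0 < X" "0 < Y" "Y < X" "X < 1" by blast+
  have "X + Y = 5 / (K + 5)"
    unfolding X_def Y_def add_divide_distrib[symmetric] using K by (simp add: divide_simps)
  then have sum: "4 * (K + 4) * (K + 5) * (X + Y) = 20 * (K + 4)"
    using K by simp
  have "2 * (K + 5) * X = 5 + s" "2 * (K + 5) * Y = 5 - s"
    using K by (simp_all add: X_def Y_def)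
  then have "X * Y * (4 * (K + 5)\<^sup>2) = 25 - s\<^sup>2" by algebra
  moreover have "(25 - s\<^sup>2) * (K + 4) = 15 * (K + 5)" using s by (simp add: algebra_simps)
  ultimately have "(K + 5) * (4 * (K + 4) * (K + 5) * (X * Y)) = (K + 5) * 15"
    by algebra
  then have prod: "4 * (K + 4) * (K + 5) * (X * Y) = 15"
    by (rule mult_left_cancel[THEN iffD1, rotated]) (use K in simp)
  define w where "w = sqrt X"
  have w: "0 < w" "w < 1" "w\<^sup>2 = X" using XY by (auto simp: w_def)
  have w4: "w ^ 4 = X\<^sup>2" using w(3) by (metis numeral_Bit0 mult_2 power_add power2_eq_square)
  have w6: "w ^ 6 = X ^ 3" using power_mult[of w 2 3] w(3) by simp
  have g5: "gegenbauer (Suc k) 5 x = (K + 1) * (K + 2) * (K + 3) / 15 *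
      (x * (4 * (K + 4) * (K + 5) * ((x\<^sup>2 - X) * (x\<^sup>2 - Y))))" for x
    using biquadratic_factor[OF sum prod, of x] unfolding gegenbauer_5
    by (simp add: K_def add_ac)
  have crit: "rightmost_crit (k + 6) k w"
  proof -
    have "gegenbauer (Suc k) 5 x > 0" if "w < x" for x
    proof -
      have "X < x\<^sup>2" using that XY less_sqrt_imp_less_square[of X x] by (simp add: w_def)
      then show ?thesis unfolding g5 using K XY w(1) that by (intro mult_pos_pos) auto
    qed
    then show ?thesis
      using rightmost_crit_gegenbauer[of w k 5] w g5[of w] by (simp add: add.commute[of k])
  qed
  have X2: "4 * (K + 4) * (K + 5) * X\<^sup>2 = 20 * (K + 4) * X - 15"
    using biquadratic_factor[OF sum prod, of w] w w4 by simp
  \<comment> \<open>Splitting \<open>X^3\<close> as \<open>X * X^2\<close> exposes the left side of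
    \<open>X2\<close>, which lowers the sextic to a quadratic in \<open>X\<close>.\<close>
  have "8 * (K + 3) * (K + 4) * (K + 5) * w ^ 6 - 60 * (K + 3) * (K + 4) * w ^ 4 + 90 * (K + 3) * w\<^sup>2 - 15
      = 2 * (K + 3) * X * (4 * (K + 4) * (K + 5) * X\<^sup>2)
        - 60 * (K + 3) * (K + 4) * X\<^sup>2 + 90 * (K + 3) * X - 15"
    unfolding w w4 w6 by algebra
  also have "\<dots> = - (20 * (K + 3) * (K + 4) * X\<^sup>2 - 60 * (K + 3) * X + 15)"
    unfolding X2 by (simp add: algebra_simps power2_eq_square)
  finally have poly6: "8 * (K + 3) * (K + 4) * (K + 5) * w ^ 6 - 60 * (K + 3) * (K + 4) * w ^ 4
      + 90 * (K + 3) * w\<^sup>2 - 15 = - (20 * (K + 3) * (K + 4) * X\<^sup>2 - 60 * (K + 3) * X + 15)" .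
  define Q where "Q = 20 * (K + 3) * (K + 4) * X\<^sup>2 - 60 * (K + 3) * X + 15"
  have XK: "2 * (K + 5) * X = 5 + s" using K by (simp add: X_def)
  have "Q * (K + 5)\<^sup>2 = 5 * (K + 3) * (K + 4) * (2 * (K + 5) * X)\<^sup>2
      - 30 * (K + 3) * (K + 5) * (2 * (K + 5) * X) + 15 * (K + 5)\<^sup>2"
    unfolding Q_def by algebra
  then have Q5: "Q * (K + 5)\<^sup>2 = 5 * (K + 3) * (K + 4) * (5 + s)\<^sup>2
      - 30 * (K + 3) * (K + 5) * (5 + s) + 15 * (K + 5)\<^sup>2"
    unfolding XK .
  have key: "Q * (K + 5)\<^sup>2 * (2 + s) = 2 * (5 + s)\<^sup>2 * ((2 * K + 3) * (2 * K + 5))"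
    unfolding Q5 using s by algebra
  \<comment> \<open>The closed form in \<open>key\<close> also yields the sign of \<open>Q\<close>,
    so no separate estimate is needed.\<close>
  have "Q * (K + 5)\<^sup>2 * (2 + s) > 0"
    unfolding key using K s0 by (intro mult_pos_pos) auto
  then have Q: "Q > 0" using K s0 by (simp add: zero_less_mult_iff)
  have g6: "gegenbauer k 6 w = K * (K + 1) * (K + 2) / 90 * - Q"
    unfolding gegenbauer_6 K_def[symmetric] poly6 Q_def ..
  have g61: "gegenbauer k 6 1 = K * (K + 1) * (K + 2) / 90 * ((2 * K + 1) * (2 * K + 3) * (2 * K + 5))"
    unfolding gegenbauer_6 K_def[symmetric] by (simp add: algebra_simps)
  have tau: "tau (k + 6) k = Q / ((2 * K + 1) * (2 * K + 3) * (2 * K + 5))"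
    unfolding tau_gegenbauer[OF crit assms(1)] g6 g61 using K Q by (simp add: abs_mult)
  have cancel: "a * d / (25 * d * b) = a / (25 * b)" if "d \<noteq> 0" for a b d :: real
    using that by simp
  have "beta k = Q * (K + 5)\<^sup>2 / (25 * ((2 * K + 3) * (2 * K + 5)))"
    unfolding beta_def tau using K by (simp add: K_def[symmetric] power_divide)
  also have "\<dots> = Q * (K + 5)\<^sup>2 * (2 + s) / (25 * ((2 * K + 3) * (2 * K + 5)) * (2 + s))"
    using s0 by simp
  also have "\<dots> = 2 * (5 + s)\<^sup>2 / (25 * (2 + s))"
    unfolding key by (rule cancel) (use K in auto)
  finally show ?thesis .
qed

subsection \<open>Dependence on the parameters\<close>

lemma alpha_param_bounds: "0 < alpha_param k" "alpha_param k < sqrt 6"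
proof -
  have "3 / (real k + 3) < 6" by (simp add: divide_less_eq)
  then show "0 < alpha_param k" by (simp add: alpha_param_def)
  show "alpha_param k < sqrt 6" by (simp add: alpha_param_def)
qed

text \<open>The bound 1 is where the derivative in \<open>beta_fun_strict_mono\<close> changes
  sign.\<close>

lemma beta_param_bounds: "1 < beta_param k" "beta_param k < sqrt 10"
proof -
  have "15 / (real k + 4) \<le> 15 / 4" by (intro divide_left_mono) auto
  then show "1 < beta_param k" by (simp add: beta_param_def)
  show "beta_param k < sqrt 10" by (simp add: beta_param_def)
qed

lemma alpha_param_strict_mono: "alpha_param k < alpha_param (Suc k)"
  by (auto simp: alpha_param_def intro!: divide_strict_left_mono)

lemma beta_param_strict_mono: "beta_param k < beta_param (Suc k)"
  by (auto simp: beta_param_def intro!: divide_strict_left_mono)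

lemma alpha_param_tendsto: "alpha_param \<longlonglongrightarrow> sqrt 6"
  unfolding alpha_param_def [abs_def] by (real_asymp simp: powr_half_sqrt)

lemma beta_param_tendsto: "beta_param \<longlonglongrightarrow> sqrt 10"
  unfolding beta_param_def [abs_def] by (real_asymp simp: powr_half_sqrt)

text \<open>Under a single square root the function is rational, with derivative
  \<open>(3 + x)^2 x / (8 (2 + x)^3)\<close>.\<close>

lemma alpha_fun_strict_mono:
  fixes s t :: real
  assumes "0 < s" "s < t"
  shows "sqrt ((3 + s) / 8) * ((3 + s) / (2 + s)) < sqrt ((3 + t) / 8) * ((3 + t) / (2 + t))"
proof -
  have eq: "sqrt ((3 + x) / 8) * ((3 + x) / (2 + x)) = sqrt ((3 + x) ^ 3 / (8 * (2 + x)\<^sup>2))"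
    if "x > 0" for x :: real
  proof -
    have "(3 + x) ^ 3 / (8 * (2 + x)\<^sup>2) = (3 + x) / 8 * ((3 + x) / (2 + x))\<^sup>2"
      by (simp add: power_divide power2_eq_square power3_eq_cube)
    then show ?thesis using that by (simp only: real_sqrt_mult) simp
  qed
  have "(3 + s) ^ 3 / (8 * (2 + s)\<^sup>2) < (3 + t) ^ 3 / (8 * (2 + t)\<^sup>2)"
  proof (rule DERIV_pos_imp_increasing[OF assms(2), of "\<lambda>x. (3 + x) ^ 3 / (8 * (2 + x)\<^sup>2)"])
    fix x assume "s \<le> x" "x \<le> t"
    with assms have x: "x > 0" by simp
    have "((\<lambda>x. (3 + x) ^ 3 / (8 * (2 + x)\<^sup>2)) has_real_derivative
        (3 + x)\<^sup>2 * x / (8 * (2 + x) ^ 3)) (at x)"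
      using x by (auto intro!: derivative_eq_intros simp: divide_simps) algebra
    moreover have "(3 + x)\<^sup>2 * x / (8 * (2 + x) ^ 3) > 0" using x by simp
    ultimately show "\<exists>y. ((\<lambda>x. (3 + x) ^ 3 / (8 * (2 + x)\<^sup>2)) has_real_derivative y) (at x) \<and> y > 0"
      by blast
  qed
  then show ?thesis using assms by (simp only: eq real_sqrt_less_iff)
qed

lemma beta_fun_strict_mono:
  fixes s t :: real
  assumes "1 < s" "s < t"
  shows "2 * (5 + s)\<^sup>2 / (25 * (2 + s)) < 2 * (5 + t)\<^sup>2 / (25 * (2 + t))"
proof (rule DERIV_pos_imp_increasing[OF assms(2), of "\<lambda>x. 2 * (5 + x)\<^sup>2 / (25 * (2 + x))"])
  fix x assume "s \<le> x" "x \<le> t"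
  with assms have x: "x > 1" by simp
  have "((\<lambda>x. 2 * (5 + x)\<^sup>2 / (25 * (2 + x))) has_real_derivative
      2 * (5 + x) * (x - 1) / (25 * (2 + x)\<^sup>2)) (at x)"
    using x by (auto intro!: derivative_eq_intros simp: divide_simps) algebra
  moreover have "2 * (5 + x) * (x - 1) / (25 * (2 + x)\<^sup>2) > 0" using x by simp
  ultimately show "\<exists>y. ((\<lambda>x. 2 * (5 + x)\<^sup>2 / (25 * (2 + x))) has_real_derivative y) (at x) \<and> y > 0"
    by blast
qed

section \<open>Limit values at \<open>s = sqrt 6\<close> and \<open>s = sqrt 10\<close>\<close>

lemma alpha_star_eq: "alpha_star = sqrt ((3 + sqrt 6) / 8) * ((3 + sqrt 6) / (2 + sqrt 6))"
proof -
  have q: "sqrt 6 * sqrt 6 = (6 :: real)" "2 + sqrt 6 > (0 :: real)" by (simp_all add: add_pos_pos)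
  then have "(3 + sqrt 6) / (2 + sqrt 6) = sqrt 6 / 2"
    using q by (simp add: divide_simps) (simp add: algebra_simps)
  then have "sqrt ((3 + sqrt 6) / 8) * ((3 + sqrt 6) / (2 + sqrt 6)) = sqrt ((3 + sqrt 6) / 8) * (sqrt 6 / 2)"
    by (rule arg_cong)
  also have "\<dots> = sqrt ((3 + sqrt 6) / 8) * sqrt (6 / 4)"
    by (simp only: real_sqrt_divide real_sqrt_four)
  also have "\<dots> = sqrt (3 * (3 + sqrt 6) / 16)"
    by (simp add: real_sqrt_mult[symmetric] algebra_simps)
  also have "\<dots> = alpha_star"
    unfolding alpha_star_def by (simp add: real_sqrt_divide)
  finally show ?thesis ..
qed

lemma beta_star_eq: "beta_star = 2 * (5 + sqrt 10)\<^sup>2 / (25 * (2 + sqrt 10))"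
proof -
  have "sqrt 10 * sqrt 10 = (10 :: real)" "2 + sqrt 10 > (0 :: real)"
    by (simp_all add: add_pos_pos)
  then show ?thesis
    unfolding beta_star_def
    by (simp add: divide_simps power2_eq_square) (simp add: algebra_simps)
qed

theorem theorem1p3:
  shows "(\<forall>k n. 1 \<le> k \<longrightarrow> k + 5 \<le> n \<longrightarrow> tau n k \<le> tau (k + 5) k)
    \<and> (\<forall>k n. 1 \<le> k \<longrightarrow> k + 6 \<le> n \<longrightarrow> tau n k \<le> tau (k + 6) k)
    \<and> (\<forall>k. 1 \<le> k \<longrightarrow> alpha k < alpha (Suc k))
    \<and> (\<forall>k. 1 \<le> k \<longrightarrow> beta k < beta (Suc k))
    \<and> alpha \<longlonglongrightarrow> alpha_star
    \<and> beta \<longlonglongrightarrow> beta_star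
    \<and> (\<forall>k. 1 \<le> k \<longrightarrow> alpha k < alpha_star)
    \<and> (\<forall>k. 1 \<le> k \<longrightarrow> beta k < beta_star)"
proof (intro conjI allI impI)
  fix k n :: nat
  show "tau n k \<le> tau (k + 5) k" if "k + 5 \<le> n"
    by (rule tau_antimono) (use that in auto)
  show "tau n k \<le> tau (k + 6) k" if "k + 6 \<le> n"
    by (rule tau_antimono) (use that in auto)
next
  fix k :: nat
  assume k: "1 \<le> k"
  show "alpha k < alpha (Suc k)"
    using k alpha_fun_strict_mono[OF alpha_param_bounds(1) alpha_param_strict_mono] by (simp add: alpha_eq)
  show "beta k < beta (Suc k)"
    using k beta_fun_strict_mono[OF beta_param_bounds(1) beta_param_strict_mono] by (simp add: beta_eq)
  show "alpha k < alpha_star"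
    using k alpha_fun_strict_mono[OF alpha_param_bounds] by (simp add: alpha_eq alpha_star_eq)
  show "beta k < beta_star"
    using k beta_fun_strict_mono[OF beta_param_bounds] by (simp add: beta_eq beta_star_eq)
next
  have nz: "2 + sqrt x \<noteq> 0" if "x \<ge> 0" for x
    using real_sqrt_ge_zero[OF that] by linarith
  have "(\<lambda>k. sqrt ((3 + alpha_param k) / 8) * ((3 + alpha_param k) / (2 + alpha_param k))) \<longlonglongrightarrow> alpha_star"
    unfolding alpha_star_eq
    by (intro tendsto_intros alpha_param_tendsto) (simp_all add: nz)
  \<comment> \<open>\<open>alpha_eq\<close> assumes \<open>k \<ge> 1\<close>, so the limit is
    transferred along eventual equality.\<close>
  then show "alpha \<longlonglongrightarrow> alpha_star"
    by (rule Lim_transform_eventually)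
      (use eventually_ge_at_top[of 1] in \<open>eventually_elim, simp add: alpha_eq\<close>)
  have "(\<lambda>k. 2 * (5 + beta_param k)\<^sup>2 / (25 * (2 + beta_param k))) \<longlonglongrightarrow> beta_star"
    unfolding beta_star_eq
    by (intro tendsto_intros beta_param_tendsto)
      (simp_all add: nz del: distrib_left_numeral)
  then show "beta \<longlonglongrightarrow> beta_star"
    by (rule Lim_transform_eventually)
      (use eventually_ge_at_top[of 1] in \<open>eventually_elim, simp add: beta_eq\<close>)
qed

end
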